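(* Let $m\ge1$, let $q_1,\ldots,q_m$ be positive integers, and let $e\in\mathbb Z$. Write $z=\rho e^{i\theta}$ with $\rho>0$ and $\theta\in\mathbb R$. For $1\le j\le m$, assume $$A_j=\operatorname{Arg}(z^{q_j})\in(0,\pi),\qquad0\le\beta_j<1,$$ and define $$M_j=\operatorname{Arg}(z^{q_j}-1),\qquad u_j=\operatorname{Arg}(z^{q_j}-\beta_j),\qquad v_j=M_j-u_j,\qquad U_j=M_j-A_j.$$ Assume both the product relation and, for an integer $L$, the real argument identity $$z^e\prod_{j=1}^m(z^{q_j}-\beta_j)=\prod_{j=1}^m(1-\beta_j),\qquad e\theta+\sum_{j=1}^mu_j=2\pi L .$$ Then $0<v_j\le U_j<\pi$, and $$S:=\sum_{j=1}^mM_j+e\theta-2\pi L=\sum_{j=1}^mv_j,\qquad0<S\le\sum_{j=1}^mU_j.$$ If $S<\sum_jU_j$, let $c\in(0,\max_jU_j)$ be the unique solution of $\sum_{j=1}^m\min(c,U_j)=S$; if $S=\sum_jU_j$, set $c=\max_jU_j$. Put $v_j^*=\min(c,U_j)$. These values uniquely maximize $\prod_j\sin v_j$ among all choices of real numbers satisfying $0<v_j\le U_j$ and $\sum_jv_j=S$. Consequently, for the given $v_j$, $$\rho^e\prod_{j=1}^m\sin M_j=\prod_{j=1}^m\sin v_j\le\prod_{j=1}^m\sin v_j^*,$$ with equality in the last inequality exactly when $v_j=v_j^*$ for every $j$. Moreover $$\log\frac{\prod_j\sin v_j^*}{\rho^e\prod_j\sin M_j}\ge\frac12\sum_{j=1}^m(v_j-v_j^*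 )^2.$$ If $S/m\le\min_jU_j$, the bound reduces to $$\rho^e\prod_{j=1}^m\sin M_j\le\sin^m(S/m),$$ with equality exactly when $v_1=\cdots=v_m=S/m$.
   Context: $\operatorname{Arg}$ denotes the principal argument in $(-\pi,\pi]$. The letter $e$ denotes the given integer exponent, except in $e^{i\theta}$. *)

theory Defs
  imports "HOL-Analysis.Analysis"
begin

end

theory Submission
  imports Defs
begin

text \<open>For \<open>w\<close> in the upper half plane and real \<open>s\<close>, \<open>t\<close> the imaginary part of
  \<open>(w - t) * cnj (w - s)\<close> is \<open>Im w * (t - s)\<close>. This orders the arguments, and with \<open>t = 1\<close> it expresses
  \<open>sin v\<close> through \<open>sin M\<close>, so that the modulus of the product relation turns into the identity
  between the two products of sines. For the optimization, \<open>ln (sin x) + x\<^sup>2 / 2\<close> is concave on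
  \<open>(0, pi)\<close>; the slopes \<open>cot (min c (U j))\<close> of the tangents at the truncated point may be
  replaced by the multiplier \<open>cot c\<close>, after which the linear terms cancel because the sums agree.\<close>

section \<open>Arguments of real translates of a point in the upper half plane\<close>

lemma Arg_pos_upper_half_plane:
  assumes "Im w > 0"
  shows "0 < Arg w" "Arg w < pi"
  using assms Arg_lt_pi[of w] by auto

lemma cmod_mult_sin_Arg:
  assumes "w \<noteq> 0"
  shows "cmod w * sin (Arg w) = Im w"
  using assms sin_Arg[of w] by simp

text \<open>Multiplying by a conjugate subtracts arguments, up to a multiple of 2 pi that the sine
  does not see.\<close>

lemma sin_Arg_diff:
  assumes "w \<noteq> 0" "w' \<noteq> 0"
  shows "cmod w * cmod w' * sin (Arg w - Arg w') = Im (w * cnj w')"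
proof -
  have "cmod w * cmod w' * sin (Arg w - Arg w')
      = (cmod w * sin (Arg w)) * (cmod w' * cos (Arg w'))
        - (cmod w * cos (Arg w)) * (cmod w' * sin (Arg w'))"
    by (simp add: sin_diff algebra_simps)
  also have "\<dots> = Im w * Re w' - Re w * Im w'"
    using assms by (simp add: sin_Arg cos_Arg)
  finally show ?thesis by simp
qed

lemma sin_Arg_translate_diff:
  fixes s t :: real
  assumes "Im w > 0"
  shows "cmod (w - of_real t) * cmod (w - of_real s)
           * sin (Arg (w - of_real t) - Arg (w - of_real s)) = Im w * (t - s)"
proof -
  have "w - of_real t \<noteq> 0" "w - of_real s \<noteq> 0"
    using assms by (auto simp: complex_eq_iff)
  from sin_Arg_diff[OF this] show ?thesis by (simp add: algebra_simps)
qed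

lemma Arg_translate_strict_mono:
  fixes s t :: real
  assumes w: "Im w > 0" and "s < t"
  shows "Arg (w - of_real s) < Arg (w - of_real t)"
proof (rule ccontr)
  \<comment> \<open>If the order failed, \<open>?d\<close> would lie in [0, pi), where the sine is
    nonnegative, whereas the translate identity gives it the sign of \<open>s - t\<close>.\<close>
  let ?d = "Arg (w - of_real s) - Arg (w - of_real t)"
  assume "\<not> ?thesis"
  moreover have "Arg (w - of_real s) < pi" "0 < Arg (w - of_real t)"
    using w by (auto intro!: Arg_pos_upper_half_plane)
  ultimately have "sin ?d \<ge> 0" by (intro sin_ge_zero) auto
  then have "cmod (w - of_real s) * cmod (w - of_real t) * sin ?d \<ge> 0" by simp
  then have "Im w * (s - t) \<ge> 0" using sin_Arg_translate_diff[OF w] by simp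
  then show False using assms by (simp add: zero_le_mult_iff)
qed

section \<open>Concavity of the logarithm of the sine and the constrained maximum\<close>

lemma ln_sin_le_tangent:
  fixes x p :: real
  assumes x: "0 < x" "x < pi" and p: "0 < p" "p < pi"
  shows "ln (sin x) \<le> ln (sin p) + cot p * (x - p) - (x - p)\<^sup>2 / 2"
proof -
  \<comment> \<open>\<open>?f\<close> has second derivative 1 / sin^2 - 1 >= 0, so it lies above its
    tangent at \<open>p\<close>. The quadratic contributions then combine to
    \<open>p * (x - p) + p^2 / 2 - x^2 / 2 = - (x - p)^2 / 2\<close>, the source of the factor 1/2
    in the final logarithmic bound.\<close>
  let ?f = "\<lambda>t::real. - ln (sin t) - t\<^sup>2 / 2"
  let ?f' = "\<lambda>t::real. - cot t - t"
  have sin: "sin t > 0" if "t \<in> {0<..<pi}" for t :: real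
    using that sin_gt_zero by auto
  have deriv: "(?f has_real_derivative ?f' t) (at t)" if "t \<in> {0<..<pi}" for t
    using sin[OF that] by (auto intro!: derivative_eq_intros simp: cot_def field_simps)
  have "convex_on {0<..<pi} ?f"
  proof (rule f''_ge0_imp_convex)
    show "((\<lambda>t. - cot t - t) has_real_derivative inverse ((sin t)\<^sup>2) - 1) (at t)"
      if "t \<in> {0<..<pi}" for t :: real
      using sin[OF that] by (auto intro!: derivative_eq_intros DERIV_cot)
    show "0 \<le> inverse ((sin t)\<^sup>2) - 1" if "t \<in> {0<..<pi}" for t :: real
      using sin[OF that] by (simp add: one_le_inverse_iff abs_square_le_1)
  qed (use deriv in auto)
  then have "?f x - ?f p \<ge> ?f' p * (x - p)"
    by (rule convex_on_imp_above_tangent)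
       (use x p deriv in \<open>auto intro: DERIV_subset\<close>)
  then show ?thesis by (simp add: power2_eq_square field_simps)
qed

lemma cot_antimono:
  fixes s t :: real
  assumes "0 < s" "s \<le> t" "t < pi"
  shows "cot t \<le> cot s"
proof -
  have pos: "sin s > 0" "sin t > 0" using assms by (auto intro: sin_gt_zero)
  have "sin (t - s) \<ge> 0" using assms by (intro sin_ge_zero) auto
  then have "cos t * sin s \<le> cos s * sin t" by (simp add: sin_diff algebra_simps)
  then show ?thesis using pos by (simp add: cot_def field_simps)
qed

lemma sum_ln_sin_le_truncated:
  fixes U x :: "'a \<Rightarrow> real" and c :: real
  assumes c: "0 < c" "c < pi"
    and U: "\<And>j. j \<in> I \<Longrightarrow> U j < pi"
    and x: "\<And>j. j \<in> I \<Longrightarrow> 0 < x j \<and> x j \<le> U j"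
    and sums: "(\<Sum>j\<in>I. x j) = (\<Sum>j\<in>I. min c (U j))"
  shows "(\<Sum>j\<in>I. ln (sin (x j)))
    \<le> (\<Sum>j\<in>I. ln (sin (min c (U j)))) - (\<Sum>j\<in>I. (x j - min c (U j))\<^sup>2) / 2"
proof -
  have "ln (sin (x j)) \<le> ln (sin (min c (U j))) + cot c * (x j - min c (U j))
          - (x j - min c (U j))\<^sup>2 / 2" if j: "j \<in> I" for j
  proof -
    have "cot (min c (U j)) * (x j - min c (U j)) \<le> cot c * (x j - min c (U j))"
    \<comment> \<open>If \<open>c\<close> \<le> \<open>U j\<close>, both slopes are
      \<open>cot c\<close>. Otherwise the truncated value is \<open>U j\<close>, and
      \<open>x j - U j\<close> \<le> 0 reverses \<open>cot c\<close> \<le> \<open>cot (U j)\<close>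
      into the required direction.\<close>
    proof (cases "c \<le> U j")
      case False
      then have "cot c \<le> cot (U j)"
        using x[OF j] c by (intro cot_antimono) auto
      then show ?thesis using False x[OF j] by (simp add: mult_right_mono_neg)
    qed simp
    moreover have "0 < x j" "x j < pi" "0 < min c (U j)" "min c (U j) < pi"
      using x[OF j] U[OF j] c by auto
    note ln_sin_le_tangent[OF this]
    ultimately show ?thesis by linarith
  qed
  then have "(\<Sum>j\<in>I. ln (sin (x j))) \<le> (\<Sum>j\<in>I. ln (sin (min c (U j)))
      + cot c * (x j - min c (U j)) - (x j - min c (U j))\<^sup>2 / 2)"
    by (rule sum_mono)
  also have "\<dots> = (\<Sum>j\<in>I. ln (sin (min c (U j)))) + cot c * ((\<Sum>j\<in>I. x j) - (\<Sum>j\<in>I. min c (U j)))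
      - (\<Sum>j\<in>I. (x j - min c (U j))\<^sup>2) / 2"
    by (simp add: sum.distrib sum_subtractf sum_distrib_left sum_divide_distrib right_diff_distrib)
  finally show ?thesis using sums by simp
qed

text \<open>All three claims follow from \<open>ln ?P\<close> \<le> \<open>ln ?Q - ?D / 2\<close>:
  equal products force the sum of squares \<open>?D\<close> to vanish, which gives uniqueness of the
  maximizer.\<close>

lemma
  fixes U x :: "'a \<Rightarrow> real" and c :: real
  assumes fin: "finite I" and c: "0 < c" "c < pi"
    and U: "\<And>j. j \<in> I \<Longrightarrow> U j < pi"
    and x: "\<And>j. j \<in> I \<Longrightarrow> 0 < x j \<and> x j \<le> U j"
    and sums: "(\<Sum>j\<in>I. x j) = (\<Sum>j\<in>I. min c (U j))"
  shows ln_prod_sin_ratio_ge: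
      "ln ((\<Prod>j\<in>I. sin (min c (U j))) / (\<Prod>j\<in>I. sin (x j))) \<ge> 1 / 2 * (\<Sum>j\<in>I. (x j - min c (U j))\<^sup>2)"
    and prod_sin_le_truncated: "(\<Prod>j\<in>I. sin (x j)) \<le> (\<Prod>j\<in>I. sin (min c (U j)))"
    and prod_sin_eq_truncatedD:
      "(\<Prod>j\<in>I. sin (x j)) = (\<Prod>j\<in>I. sin (min c (U j))) \<Longrightarrow> \<forall>j\<in>I. x j = min c (U j)"
proof -
  let ?P = "\<Prod>j\<in>I. sin (x j)" and ?Q = "\<Prod>j\<in>I. sin (min c (U j))"
  let ?D = "\<Sum>j\<in>I. (x j - min c (U j))\<^sup>2"
  have sx: "sin (x j) > 0" if "j \<in> I" for j
    using x[OF that] U[OF that] by (intro sin_gt_zero) auto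
  have sm: "sin (min c (U j)) > 0" if "j \<in> I" for j
    using x[OF that] c by (intro sin_gt_zero) auto
  have pos: "?P > 0" "?Q > 0" by (auto intro!: prod_pos sx sm)
  have "ln ?P = (\<Sum>j\<in>I. ln (sin (x j)))" "ln ?Q = (\<Sum>j\<in>I. ln (sin (min c (U j))))"
    using fin sx sm by (auto intro!: ln_prod simp: less_imp_neq[symmetric])
  with sum_ln_sin_le_truncated[OF c U x sums] have le: "ln ?P \<le> ln ?Q - ?D / 2" by simp
  then show "ln (?Q / ?P) \<ge> 1 / 2 * ?D" using pos by (simp add: ln_div)
  have "?D \<ge> 0" by (simp add: sum_nonneg)
  with le pos show "?P \<le> ?Q" by (simp flip: ln_le_cancel_iff)
  assume "?P = ?Q"
  with le \<open>?D \<ge> 0\<close> have "?D = 0" by simp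
  then show "\<forall>j\<in>I. x j = min c (U j)" using fin by (simp add: sum_nonneg_eq_0_iff)
qed

section \<open>The truncation level\<close>

lemma ex1_truncation_level:
  fixes U :: "'a \<Rightarrow> real" and S :: real
  assumes fin: "finite I" "I \<noteq> {}" and U: "\<And>j. j \<in> I \<Longrightarrow> 0 < U j"
    and S: "0 < S" "S < (\<Sum>j\<in>I. U j)"
  shows "\<exists>!t. 0 < t \<and> t < Max (U ` I) \<and> (\<Sum>j\<in>I. min t (U j)) = S"
proof -
  let ?F = "\<lambda>t. \<Sum>j\<in>I. min t (U j)"
  have "Max (U ` I) \<in> U ` I" using fin by (intro Max_in) auto
  then obtain k where k: "k \<in> I" "U k = Max (U ` I)" by auto
  have le: "U j \<le> Max (U ` I)" if "j \<in> I" for j using fin that by simp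
  have F0: "?F 0 = 0" using U by (intro sum.neutral) (auto simp: min_def dest: less_imp_le)
  have FM: "?F (Max (U ` I)) = (\<Sum>j\<in>I. U j)" using le by (intro sum.cong) auto
  have "Max (U ` I) > 0" using U k by metis
  moreover have "continuous_on {0..Max (U ` I)} ?F" by (intro continuous_intros)
  ultimately have "\<exists>t\<ge>0. t \<le> Max (U ` I) \<and> ?F t = S"
    using F0 FM S by (intro IVT') auto
  then obtain t where t: "0 \<le> t" "t \<le> Max (U ` I)" "?F t = S" by blast
  have "t \<noteq> 0" "t \<noteq> Max (U ` I)" using t(3) F0 FM S by auto
  \<comment> \<open>Below the maximum the term at the maximizing index \<open>k\<close> is
    \<open>t\<close> itself, hence strictly increasing, while the other terms are nondecreasing.
    Above the maximum \<open>?F\<close> is constant.\<close>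
  moreover have strict: "?F a < ?F b" if "a < b" "b < Max (U ` I)" for a b
    using fin k that by (intro sum_strict_mono_ex1) (auto intro!: bexI[of _ k])
  have "s = s'" if "s < Max (U ` I)" "?F s = S" "s' < Max (U ` I)" "?F s' = S" for s s'
    using strict[of s s'] strict[of s' s] that by (cases s s' rule: linorder_cases) auto
  ultimately show ?thesis using t by (intro ex_ex1I) (auto intro!: exI[of _ t])
qed

text \<open>Depending on the side of \<open>a\<close> on which \<open>c\<close> lies, the truncated
  values are all at most \<open>a\<close> or all at least \<open>a\<close>; having average
  \<open>a\<close>, they must all equal it. The conclusion concerns the truncated values because
  \<open>c > a\<close> can occur when every \<open>U j\<close> equals \<open>a\<close>.\<close>

lemma truncation_eq_average:
  fixes U :: "'a \<Rightarrow> real" and a c :: real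
  assumes "finite I" and "\<And>j. j \<in> I \<Longrightarrow> a \<le> U j"
    and sum: "(\<Sum>j\<in>I. min c (U j)) = real (card I) * a" and j: "j \<in> I"
  shows "min c (U j) = a"
proof (cases "c \<le> a")
  case True
  then show ?thesis using assms sum_mono_inv[of "\<lambda>j. min c (U j)" I "\<lambda>_. a" j] by auto
next
  case False
  then show ?thesis using assms sum_mono_inv[of "\<lambda>_. a" I "\<lambda>j. min c (U j)" j] by auto
qed

section \<open>Application to the product relation\<close>

theorem theoremA2:
  fixes m :: nat and q :: "nat \<Rightarrow> nat" and e L :: int
    and z :: complex and \<rho> \<theta> S c :: real
    and \<beta> A M u v U vstar :: "nat \<Rightarrow> real"
  assumes m: "m \<ge> 1"
    and q: "\<And>j. j \<in> {1..m} \<Longrightarrow> q j > 0"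
    and rho: "\<rho> > 0"
    and z: "z = complex_of_real \<rho> * exp (\<i> * complex_of_real \<theta>)"
    and A: "\<And>j. j \<in> {1..m} \<Longrightarrow> A j = Arg (z ^ q j)"
    and A_range: "\<And>j. j \<in> {1..m} \<Longrightarrow> 0 < A j \<and> A j < pi"
    and beta: "\<And>j. j \<in> {1..m} \<Longrightarrow> 0 \<le> \<beta> j \<and> \<beta> j < 1"
    and M: "\<And>j. j \<in> {1..m} \<Longrightarrow> M j = Arg (z ^ q j - 1)"
    and u: "\<And>j. j \<in> {1..m} \<Longrightarrow> u j = Arg (z ^ q j - complex_of_real (\<beta> j))"
    and v: "\<And>j. j \<in> {1..m} \<Longrightarrow> v j = M j - u j"
    and U: "\<And>j. j \<in> {1..m} \<Longrightarrow> U j = M j - A j"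
    and product_relation:
      "z powi e * (\<Prod>j=1..m. z ^ q j - complex_of_real (\<beta> j))
         = complex_of_real (\<Prod>j=1..m. 1 - \<beta> j)"
    and argument_identity:
      "real_of_int e * \<theta> + (\<Sum>j=1..m. u j) = 2 * pi * real_of_int L"
    and S: "S = (\<Sum>j=1..m. M j) + real_of_int e * \<theta> - 2 * pi * real_of_int L"
    and c_less: "S < (\<Sum>j=1..m. U j) \<Longrightarrow>
      c = (THE t. 0 < t \<and> t < Max (U ` {1..m}) \<and> (\<Sum>j=1..m. min t (U j)) = S)"
    and c_eq: "S = (\<Sum>j=1..m. U j) \<Longrightarrow> c = Max (U ` {1..m})"
    and vstar: "\<And>j. j \<in> {1..m} \<Longrightarrow> vstar j = min c (U j)"
  shows
    "(\<forall>j\<in>{1..m}. 0 < v j \<and> v j \<le> U j \<and> U j < pi)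
     \<and> S = (\<Sum>j=1..m. v j) \<and> 0 < S \<and> S \<le> (\<Sum>j=1..m. U j)
     \<and> (S < (\<Sum>j=1..m. U j) \<longrightarrow>
          (\<exists>!t. 0 < t \<and> t < Max (U ` {1..m}) \<and> (\<Sum>j=1..m. min t (U j)) = S))
     \<and> (\<forall>j\<in>{1..m}. 0 < vstar j \<and> vstar j \<le> U j) \<and> (\<Sum>j=1..m. vstar j) = S
     \<and> (\<forall>x :: nat \<Rightarrow> real.
          (\<forall>j\<in>{1..m}. 0 < x j \<and> x j \<le> U j) \<and> (\<Sum>j=1..m. x j) = S \<longrightarrow>
            (\<Prod>j=1..m. sin (x j)) \<le> (\<Prod>j=1..m. sin (vstar j))
            \<and> ((\<Prod>j=1..m. sin (x j)) = (\<Prod>j=1..m. sin (vstar j)) \<longrightarrow>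
                 (\<forall>j\<in>{1..m}. x j = vstar j)))
     \<and> \<rho> powi e * (\<Prod>j=1..m. sin (M j)) = (\<Prod>j=1..m. sin (v j))
     \<and> (\<Prod>j=1..m. sin (v j)) \<le> (\<Prod>j=1..m. sin (vstar j))
     \<and> ((\<Prod>j=1..m. sin (v j)) = (\<Prod>j=1..m. sin (vstar j)) \<longleftrightarrow>
          (\<forall>j\<in>{1..m}. v j = vstar j))
     \<and> ln ((\<Prod>j=1..m. sin (vstar j)) / (\<rho> powi e * (\<Prod>j=1..m. sin (M j))))
          \<ge> 1 / 2 * (\<Sum>j=1..m. (v j - vstar j)\<^sup>2)
     \<and> (S / real m \<le> Min (U ` {1..m}) \<longrightarrow>
          (\<Prod>j=1..m. sin (vstar j)) = sin (S / real m) ^ m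
          \<and> \<rho> powi e * (\<Prod>j=1..m. sin (M j)) \<le> sin (S / real m) ^ m
          \<and> (\<rho> powi e * (\<Prod>j=1..m. sin (M j)) = sin (S / real m) ^ m \<longleftrightarrow>
               (\<forall>j\<in>{1..m}. v j = S / real m)))"
proof -
  let ?I = "{1..m}"
  have fin: "finite ?I" "?I \<noteq> {}" using m by auto
  define w where "w j = z ^ q j" for j
  have imw: "Im (w j) > 0" if "j \<in> ?I" for j
    using A[OF that] A_range[OF that] Arg_lt_pi[of "w j"] by (simp add: w_def)
  \<comment> \<open>Writing all three arguments as those of translates by 1,
    \<open>\<beta> j\<close> and 0 lets monotonicity in the translate give \<open>A j\<close> \<le>
    \<open>u j\<close> < \<open>M j\<close>.\<close>
  have M': "M j = Arg (w j - of_real 1)" and u': "u j = Arg (w j - of_real (\<beta> j))"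
    and A': "A j = Arg (w j - of_real 0)" if "j \<in> ?I" for j
    using M u A that by (auto simp: w_def)
  have vU: "0 < v j \<and> v j \<le> U j \<and> U j < pi" if j: "j \<in> ?I" for j
  proof -
    have "u j < M j"
      unfolding u'[OF j] M'[OF j]
      using beta[OF j] by (intro Arg_translate_strict_mono imw j) auto
    \<comment> \<open>Strict monotonicity covers \<open>\<beta> j > 0\<close>; for
      \<open>\<beta> j = 0\<close> the two arguments coincide and \<open>v j = U j\<close>.\<close>
    moreover have "A j \<le> u j"
    proof (cases "\<beta> j = 0")
      case False
      then have "A j < u j"
        unfolding u'[OF j] A'[OF j]
        using beta[OF j] by (intro Arg_translate_strict_mono imw j) auto
      then show ?thesis by simp
    qed (use u'[OF j] A'[OF j] in simp)
    moreover have "M j \<le> pi" using Arg_le_pi M'[OF j] by simp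
    ultimately show ?thesis using v[OF j] U[OF j] A_range[OF j] by linarith
  qed
  \<comment> \<open>The argument identity holds over the reals, not only modulo 2 pi, so it replaces
    \<open>e * \<theta> - 2 * pi * L\<close> by minus the sum of the \<open>u j\<close>
    exactly.\<close>
  have Sv: "S = (\<Sum>j=1..m. v j)"
  proof -
    have "(\<Sum>j=1..m. v j) = (\<Sum>j=1..m. M j) - (\<Sum>j=1..m. u j)"
      by (simp add: v sum_subtractf)
    then show ?thesis using S argument_identity by linarith
  qed
  have Spos: "0 < S" unfolding Sv using fin vU by (intro sum_pos) auto
  have SU: "S \<le> (\<Sum>j=1..m. U j)" unfolding Sv using vU by (intro sum_mono) auto
  have Upos: "0 < U j" if "j \<in> ?I" for j using vU[OF that] by linarith
  have ex1: "\<exists>!t. 0 < t \<and> t < Max (U ` ?I) \<and> (\<Sum>j=1..m. min t (U j)) = S"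
    if "S < (\<Sum>j=1..m. U j)"
    by (intro ex1_truncation_level fin Spos Upos that)
  have Max: "0 < Max (U ` ?I)" "Max (U ` ?I) < pi"
    using Upos vU fin m by (auto simp: Max_gr_iff intro!: bexI[of _ 1])
  \<comment> \<open>Both cases in the choice of \<open>c\<close> yield these same three facts, and
    the rest of the argument relies on \<open>c\<close> only through them.\<close>
  have c: "0 < c \<and> c < pi \<and> (\<Sum>j=1..m. min c (U j)) = S"
  proof (cases "S < (\<Sum>j=1..m. U j)")
    case True
    show ?thesis using theI'[OF ex1[OF True]] c_less[OF True] Max by auto
  next
    case False
    then have eq: "S = (\<Sum>j=1..m. U j)" using SU by simp
    have "(\<Sum>j=1..m. min (Max (U ` ?I)) (U j)) = (\<Sum>j=1..m. U j)"
      by (intro sum.cong) (auto simp: min_absorb2)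
    then show ?thesis using c_eq[OF eq] Max eq by simp
  qed
  have vs: "0 < vstar j \<and> vstar j \<le> U j" if "j \<in> ?I" for j
    using vstar[OF that] vU[OF that] c by auto
  have vsS: "(\<Sum>j=1..m. vstar j) = S" using c by (simp add: vstar)
  have cpos: "0 < c" and cpi: "c < pi" and cS: "(\<Sum>j=1..m. min c (U j)) = S"
    using c by auto
  have Upi: "U j < pi" if "j \<in> ?I" for j using vU[OF that] by simp
  note opt = ln_prod_sin_ratio_ge[where U = U, OF fin(1) cpos cpi]
    prod_sin_le_truncated[where U = U, OF fin(1) cpos cpi]
    prod_sin_eq_truncatedD[where U = U, OF fin(1) cpos cpi]
  have sin_vs: "(\<Prod>j=1..m. sin (vstar j)) = (\<Prod>j=1..m. sin (min c (U j)))"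
    by (simp add: vstar)
  have maximal: "(\<Prod>j=1..m. sin (x j)) \<le> (\<Prod>j=1..m. sin (vstar j))
      \<and> ((\<Prod>j=1..m. sin (x j)) = (\<Prod>j=1..m. sin (vstar j)) \<longrightarrow> (\<forall>j\<in>?I. x j = vstar j))"
    if "\<forall>j\<in>?I. 0 < x j \<and> x j \<le> U j" "(\<Sum>j=1..m. x j) = S" for x
  proof -
    have x: "\<And>j. j \<in> ?I \<Longrightarrow> 0 < x j \<and> x j \<le> U j" using that by blast
    have sums: "(\<Sum>j=1..m. x j) = (\<Sum>j=1..m. min c (U j))" using that cS by simp
    show ?thesis unfolding sin_vs using opt(2,3)[OF Upi x sums] by (simp add: vstar)
  qed
  have prod: "\<rho> powi e * (\<Prod>j=1..m. sin (M j)) = (\<Prod>j=1..m. sin (v j))"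
  proof -
    define P where "P = (\<Prod>j=1..m. cmod (w j - of_real (\<beta> j)))"
    have "cmod z = \<rho>" using rho z by (simp add: norm_mult)
    \<comment> \<open>Taking moduli removes \<theta>; the right-hand side is its own modulus since
      every \<open>\<beta> j\<close> is below 1.\<close>
    have "\<rho> powi e * P = (\<Prod>j=1..m. 1 - \<beta> j)"
    proof -
      have "cmod (z powi e * (\<Prod>j=1..m. z ^ q j - of_real (\<beta> j))) = \<bar>\<Prod>j=1..m. 1 - \<beta> j\<bar>"
        unfolding product_relation by (rule norm_of_real)
      moreover have "(\<Prod>j=1..m. 1 - \<beta> j) \<ge> 0" using beta by (intro prod_nonneg) force
      ultimately show ?thesis
        by (simp add: norm_mult norm_power_int prod_norm[symmetric] w_def P_def \<open>cmod z = \<rho>\<close>)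
    qed
    moreover have "cmod (w j - of_real (\<beta> j)) * sin (v j) = (1 - \<beta> j) * sin (M j)"
      and "cmod (w j - of_real (\<beta> j)) > 0" if j: "j \<in> ?I" for j
    proof -
      have ne: "w j - of_real t \<noteq> 0" for t using imw[OF j] by (auto simp: complex_eq_iff)
      then show "cmod (w j - of_real (\<beta> j)) > 0" by simp
      \<comment> \<open>Translates by 1 and \<open>\<beta> j\<close> have arguments differing by
        \<open>v j\<close>. Expressing \<open>Im (w j)\<close> through \<open>sin (M j)\<close> as
        well makes \<open>cmod (w j - 1)\<close> a common factor that cancels.\<close>
      have "cmod (w j - of_real 1) * (cmod (w j - of_real (\<beta> j)) * sin (v j)) = Im (w j) * (1 - \<beta> j)"
        using sin_Arg_translate_diff[OF imw[OF j], of 1 "\<beta> j"]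
        by (simp add: v[OF j] M'[OF j] u'[OF j] mult.assoc)
      also have "Im (w j) = cmod (w j - of_real 1) * sin (M j)"
        using cmod_mult_sin_Arg[OF ne[of 1]] M'[OF j] by simp
      finally have "cmod (w j - of_real 1) * (cmod (w j - of_real (\<beta> j)) * sin (v j))
          = cmod (w j - of_real 1) * ((1 - \<beta> j) * sin (M j))"
        by (simp only: mult_ac)
      then show "cmod (w j - of_real (\<beta> j)) * sin (v j) = (1 - \<beta> j) * sin (M j)"
        using ne[of 1] by simp
    qed
    then have "P * (\<Prod>j=1..m. sin (v j))
        = (\<Prod>j=1..m. 1 - \<beta> j) * (\<Prod>j=1..m. sin (M j))"
      and "P > 0"
      by (auto simp: P_def simp flip: prod.distrib intro!: prod.cong prod_pos)
    \<comment> \<open>The product of the \<open>1 - \<beta> j\<close> is eliminated between the two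
      identities, leaving the positive factor \<open>P\<close> on both sides.\<close>
    ultimately have "P * (\<Prod>j=1..m. sin (v j))
        = \<rho> powi e * P * (\<Prod>j=1..m. sin (M j))"
      by (simp only:)
    then show ?thesis using \<open>P > 0\<close> by (simp add: mult.commute mult.left_commute)
  qed
  have v_le: "(\<Prod>j=1..m. sin (v j)) \<le> (\<Prod>j=1..m. sin (vstar j))"
    and v_eqD: "(\<Prod>j=1..m. sin (v j)) = (\<Prod>j=1..m. sin (vstar j)) \<Longrightarrow> \<forall>j\<in>?I. v j = vstar j"
    using maximal[OF _ Sv[symmetric]] vU by blast+
  have v_eq: "(\<Prod>j=1..m. sin (v j)) = (\<Prod>j=1..m. sin (vstar j)) \<longleftrightarrow> (\<forall>j\<in>?I. v j = vstar j)"
    by (rule iffI[OF v_eqD]) (auto intro!: prod.cong)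
  have log: "ln ((\<Prod>j=1..m. sin (vstar j)) / (\<rho> powi e * (\<Prod>j=1..m. sin (M j))))
      \<ge> 1 / 2 * (\<Sum>j=1..m. (v j - vstar j)\<^sup>2)"
  proof -
    have "0 < v j \<and> v j \<le> U j" if "j \<in> ?I" for j using vU[OF that] by simp
    from opt(1)[OF Upi this] show ?thesis unfolding prod sin_vs using Sv cS by (simp add: vstar)
  qed
  have average: "(\<Prod>j=1..m. sin (vstar j)) = sin (S / real m) ^ m
      \<and> \<rho> powi e * (\<Prod>j=1..m. sin (M j)) \<le> sin (S / real m) ^ m
      \<and> (\<rho> powi e * (\<Prod>j=1..m. sin (M j)) = sin (S / real m) ^ m \<longleftrightarrow>
           (\<forall>j\<in>?I. v j = S / real m))" if "S / real m \<le> Min (U ` ?I)"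
  proof -
    \<comment> \<open>The truncated values sum to \<open>S\<close>, so their average is
      \<open>S / m\<close>, which by assumption lies below every \<open>U j\<close>.\<close>
    have "vstar j = S / real m" if j: "j \<in> ?I" for j
      unfolding vstar[OF j]
      using \<open>S / real m \<le> Min (U ` ?I)\<close> fin m cS j by (intro truncation_eq_average[of ?I]) auto
    then show ?thesis using v_le v_eq unfolding prod by simp
  qed
  have "\<forall>j\<in>?I. 0 < v j \<and> v j \<le> U j \<and> U j < pi"
    and "\<forall>j\<in>?I. 0 < vstar j \<and> vstar j \<le> U j"
    using vU vs by blast+
  note bounds = this
  show ?thesis
    by (intro conjI bounds Sv Spos SU vsS prod v_le v_eq log)
       (intro allI impI, (elim conjE)?, rule ex1 maximal average; assumption)+
qed

end
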